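(* Let $1\le n\le N$ and let $\Lambda$ be a positive definite diagonal $N\times N$ real matrix. The map $\mathfrak M:T^\star V(n,N)\to W^0_{n,N}$ defined by $\mathfrak M((Q,S))=(Q,P_0)$ is a diffeomorphism, where $P_0$ is given in terms of $Q$ and $S=QU\Lambda$ by $$P_0=S+DQ,\qquad D=D^{\mathsf T}=\tfrac12Q[\Lambda,U]Q^{\mathsf T}=-\tfrac12(QS^{\mathsf T}+SQ^{\mathsf T}).$$ The inverse of this diffeomorphism is given by $\mathfrak M^{-1}:(Q,P_0)\mapsto(Q,S)$, where $$S=P_0-\Big[(Q\Lambda^{-1}P_0^{\mathsf T})(Q\Lambda^{-1}Q^{\mathsf T})^{-1}-Q\Lambda^{-1}Q^{\mathsf T}\,\widehat{J_Q}^{-1}(R_0)\Big]Q,$$ with $$R_0=(Q\Lambda^{-1}P_0^{\mathsf T})(Q\Lambda^{-1}Q^{\mathsf T})^{-1}-(Q\Lambda^{-1}Q^{\mathsf T})^{-1}(P_0\Lambda^{-1}Q^{\mathsf T})$$ and $\widehat{J_Q}:\mathfrak{so}(n)\to\mathfrak{so}(n)$ the (invertible) map $\widehat{J_Q}(X)=(Q\Lambda^{-1}Q^{\mathsf T})X+X(Q\Lambda^{-1}Q^{\mathsf T})$.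
   Context: $\mathbb R^{nN}$ denotes the real $n\times N$ matrices; $\mathfrak{so}(r)$ is the space of real skew-symmetric $r\times r$ matrices; $[A,B]=AB-BA$. $V(n,N)=\{Q\in\mathbb R^{nN}:QQ^{\mathsf T}=I_n\}$, with tangent space $T_QV(n,N)=\{QU: U\in\mathfrak{so}(N)\}$. Here the cotangent bundle $T^\star V(n,N)$ is parametrized by the pairs $(Q,S)\in V(n,N)\times\mathbb R^{nN}$ with $S=QU\Lambda$ for some $U\in\mathfrak{so}(N)$ (the covector being $\Gamma\mapsto\operatorname{Tr}(S^{\mathsf T}\Gamma)$ on $T_QV(n,N)$). $W^0_{n,N}=\{(Q,P)\in\mathbb R^{nN}\times\mathbb R^{nN}: QQ^{\mathsf T}=I_n,\ QP^{\mathsf T}+PQ^{\mathsf T}=0\}$. *)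

theory Defs
  imports "HOL-Analysis.Analysis"
begin

section \<open>Smooth maps, embedded submanifolds and diffeomorphisms\<close>

text \<open>Iterated directional derivatives; both predicates are meant for open \<open>S\<close>.\<close>

primrec times_differentiable_on ::
    "nat \<Rightarrow> 'a::euclidean_space set \<Rightarrow> ('a \<Rightarrow> 'b::euclidean_space) \<Rightarrow> bool" where
  "times_differentiable_on 0 S f \<longleftrightarrow> continuous_on S f"
| "times_differentiable_on (Suc k) S f \<longleftrightarrow>
     (\<forall>x\<in>S. f differentiable (at x)) \<and>
     (\<forall>v. times_differentiable_on k S (\<lambda>x. frechet_derivative f (at x) v))"

definition smooth_on :: "'a::euclidean_space set \<Rightarrow> ('a \<Rightarrow> 'b::euclidean_space) \<Rightarrow> bool" where
  "smooth_on S f \<longleftrightarrow> (\<forall>k. times_differentiable_on k S f)"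

text \<open>Smoothness on an arbitrary subset of a Euclidean space: local existence of smooth
  extensions. On an embedded submanifold this is smoothness for its manifold structure.\<close>

definition smooth_map_on :: "'a::euclidean_space set \<Rightarrow> ('a \<Rightarrow> 'b::euclidean_space) \<Rightarrow> bool" where
  "smooth_map_on X f \<longleftrightarrow>
     (\<forall>p\<in>X. \<exists>W g. open W \<and> p \<in> W \<and> smooth_on W g \<and> (\<forall>x\<in>X \<inter> W. g x = f x))"

text \<open>A \<open>k\<close>-dimensional embedded submanifold is locally the zero set of a smooth submersion.
  As \<open>HOL\<close> cannot quantify over the type of the target, the target is a linear subspace \<open>F\<close>
  of the ambient space, of dimension equal to the codimension.\<close>

definition smooth_submanifold :: "nat \<Rightarrow> 'a::euclidean_space set \<Rightarrow> bool" where
  "smooth_submanifold k X \<longleftrightarrow>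
     (\<forall>p\<in>X. \<exists>W F (g :: 'a \<Rightarrow> 'a).
        open W \<and> p \<in> W \<and> subspace F \<and> dim F + k = DIM('a) \<and>
        smooth_on W g \<and> g ` W \<subseteq> F \<and> X \<inter> W = {x \<in> W. g x = 0} \<and>
        (\<forall>x\<in>X \<inter> W. range (frechet_derivative g (at x)) = F))"

definition diffeomorphism ::
    "'a::euclidean_space set \<Rightarrow> 'b::euclidean_space set \<Rightarrow> ('a \<Rightarrow> 'b) \<Rightarrow> bool" where
  "diffeomorphism X Y f \<longleftrightarrow>
     (\<exists>k. smooth_submanifold k X) \<and> (\<exists>k. smooth_submanifold k Y) \<and>
     bij_betw f X Y \<and> smooth_map_on X f \<and> smooth_map_on Y (inv_into X f)"


section \<open>Matrices\<close>

definition diagonal_matrix :: "real^'m^'m \<Rightarrow> bool" where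
  "diagonal_matrix A \<longleftrightarrow> (\<forall>i j. i \<noteq> j \<longrightarrow> A $ i $ j = 0)"

definition positive_definite :: "real^'m^'m \<Rightarrow> bool" where
  "positive_definite A \<longleftrightarrow> transpose A = A \<and> (\<forall>x. x \<noteq> 0 \<longrightarrow> x \<bullet> (A *v x) > 0)"

definition so :: "(real^'m^'m) set" where
  "so = {A. transpose A = - A}"

definition commutator :: "real^'m^'m \<Rightarrow> real^'m^'m \<Rightarrow> real^'m^'m" where
  "commutator A B = A ** B - B ** A"


section \<open>The Stiefel manifold and its cotangent bundle\<close>

definition stiefel :: "(real^'N^'n) set" where
  "stiefel = {Q. Q ** transpose Q = mat 1}"

definition stiefel_tangent :: "real^'N^'n \<Rightarrow> (real^'N^'n) set" where
  "stiefel_tangent Q = {Q ** U | U. U \<in> so}"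

text \<open>The pair \<open>(Q, S)\<close> stands for the covector \<open>\<Gamma> \<mapsto> trace (transpose S ** \<Gamma>)\<close> on the tangent
  space at \<open>Q\<close>; see \<open>stiefel_covector_unique\<close> below.\<close>

definition stiefel_cotangent_bundle :: "real^'N^'N \<Rightarrow> ((real^'N^'n) \<times> (real^'N^'n)) set" where
  "stiefel_cotangent_bundle \<Lambda> = {(Q, S). Q \<in> stiefel \<and> (\<exists>U\<in>so. S = Q ** U ** \<Lambda>)}"

definition W0 :: "((real^'N^'n) \<times> (real^'N^'n)) set" where
  "W0 = {(Q, P). Q ** transpose Q = mat 1 \<and> Q ** transpose P + P ** transpose Q = 0}"

definition D_map :: "real^'N^'n \<Rightarrow> real^'N^'n \<Rightarrow> real^'n^'n" where
  "D_map Q S = - ((1/2) *\<^sub>R (Q ** transpose S + S ** transpose Q))"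

definition M_map :: "(real^'N^'n) \<times> (real^'N^'n) \<Rightarrow> (real^'N^'n) \<times> (real^'N^'n)" where
  "M_map = (\<lambda>(Q, S). (Q, S + D_map Q S ** Q))"

definition J_hat :: "real^'N^'N \<Rightarrow> real^'N^'n \<Rightarrow> real^'n^'n \<Rightarrow> real^'n^'n" where
  "J_hat \<Lambda> Q X = (Q ** matrix_inv \<Lambda> ** transpose Q) ** X + X ** (Q ** matrix_inv \<Lambda> ** transpose Q)"

definition R0_map :: "real^'N^'N \<Rightarrow> real^'N^'n \<Rightarrow> real^'N^'n \<Rightarrow> real^'n^'n" where
  "R0_map \<Lambda> Q P =
     (Q ** matrix_inv \<Lambda> ** transpose P) ** matrix_inv (Q ** matrix_inv \<Lambda> ** transpose Q)
     - matrix_inv (Q ** matrix_inv \<Lambda> ** transpose Q) ** (P ** matrix_inv \<Lambda> ** transpose Q)"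

definition S_map :: "real^'N^'N \<Rightarrow> real^'N^'n \<Rightarrow> real^'N^'n \<Rightarrow> real^'N^'n" where
  "S_map \<Lambda> Q P =
     P - ((Q ** matrix_inv \<Lambda> ** transpose P) ** matrix_inv (Q ** matrix_inv \<Lambda> ** transpose Q)
          - (Q ** matrix_inv \<Lambda> ** transpose Q) ** inv_into so (J_hat \<Lambda> Q) (R0_map \<Lambda> Q P)) ** Q"


section \<open>The pairs parametrize the cotangent bundle\<close>

lemma trace_transpose_mult_inner:
  fixes S \<Gamma> :: "real^'N^'n"
  shows "trace (transpose S ** \<Gamma>) = S \<bullet> \<Gamma>"
proof -
  have "trace (transpose S ** \<Gamma>) = (\<Sum>j\<in>UNIV. \<Sum>i\<in>UNIV. S $ i $ j * \<Gamma> $ i $ j)"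
    by (simp add: trace_def matrix_matrix_mult_def transpose_def)
  also have "\<dots> = (\<Sum>i\<in>UNIV. \<Sum>j\<in>UNIV. S $ i $ j * \<Gamma> $ i $ j)"
    by (rule sum.swap)
  also have "\<dots> = S \<bullet> \<Gamma>"
    by (simp add: inner_vec_def)
  finally show ?thesis .
qed

lemma subspace_so: "subspace (so :: (real^'m^'m) set)"
proof -
  have "transpose (0 :: real^'m^'m) = 0"
    and "transpose (A + B) = transpose A + transpose B"
    and "transpose (c *\<^sub>R A) = c *\<^sub>R transpose A" for A B :: "real^'m^'m" and c
    by (simp_all add: transpose_def vec_eq_iff)
  thus ?thesis
    by (simp add: subspace_def so_def)
qed

lemma linear_matrix_mult_left: "linear (\<lambda>X::real^'k^'m. A ** X)"
proof (rule linearI)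
  show "A ** (X + Y) = A ** X + A ** Y" for X Y :: "real^'k^'m"
    by (rule matrix_add_ldistrib)
  show "A ** (c *\<^sub>R X) = c *\<^sub>R (A ** X)" for c and X :: "real^'k^'m"
    by (simp only: matrix_scalar_ac scalar_matrix_assoc)
qed

lemma linear_matrix_mult_right: "linear (\<lambda>X::real^'m^'k. X ** A)"
proof (rule linearI)
  show "(X + Y) ** A = X ** A + Y ** A" for X Y :: "real^'m^'k"
    by (simp add: matrix_matrix_mult_def vec_eq_iff distrib_right sum.distrib)
  show "(c *\<^sub>R X) ** A = c *\<^sub>R (X ** A)" for c and X :: "real^'m^'k"
    by (simp only: scalar_matrix_assoc)
qed

lemma subspace_stiefel_tangent: "subspace (stiefel_tangent Q)"
proof -
  have "stiefel_tangent Q = (\<lambda>U. Q ** U) ` so"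
    by (auto simp: stiefel_tangent_def)
  thus ?thesis
    using linear_subspace_image[OF linear_matrix_mult_left subspace_so] by metis
qed

lemma positive_definite_diagonal_inner:
  fixes X :: "real^'N^'n"
  assumes "diagonal_matrix \<Lambda>" "positive_definite \<Lambda>" "X \<noteq> 0"
  shows "(X ** \<Lambda>) \<bullet> X > 0"
proof -
  have row: "(X ** \<Lambda>) $ i = \<Lambda> *v (X $ i)" for i
  proof -
    have "X ** \<Lambda> = transpose (\<Lambda> ** transpose X)"
      using assms(2) by (simp add: positive_definite_def matrix_transpose_mul)
    also have "transpose (\<Lambda> ** transpose X) $ i = \<Lambda> *v (X $ i)"
      by (simp add: vec_eq_iff transpose_def matrix_matrix_mult_def matrix_vector_mult_def)
    finally show ?thesis .
  qed
  obtain i where i: "X $ i \<noteq> 0"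
    using assms(3) by (auto simp: vec_eq_iff)
  have "0 \<le> (X ** \<Lambda>) $ j \<bullet> X $ j" for j
    using assms(2) unfolding row positive_definite_def
    by (cases "X $ j = 0") (auto simp: inner_commute less_imp_le)
  moreover have "0 < (X ** \<Lambda>) $ i \<bullet> X $ i"
    using assms(2) i unfolding row positive_definite_def by (auto simp: inner_commute)
  ultimately show ?thesis
    unfolding inner_vec_def[of "X ** \<Lambda>"] by (intro sum_pos2[of UNIV i]) auto
qed

lemma stiefel_covector_unique:
  fixes \<Lambda> :: "real^'N^'N" and Q :: "real^'N^'n" and \<phi> :: "real^'N^'n \<Rightarrow> real"
  assumes \<Lambda>: "diagonal_matrix \<Lambda>" "positive_definite \<Lambda>"
    and Q: "Q \<in> stiefel" and \<phi>: "linear \<phi>"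
  shows "\<exists>!S. (Q, S) \<in> stiefel_cotangent_bundle \<Lambda> \<and>
              (\<forall>\<Gamma>\<in>stiefel_tangent Q. \<phi> \<Gamma> = trace (transpose S ** \<Gamma>))"
proof -
  define T where "T = stiefel_tangent Q"
  define C where "C = (\<lambda>X. X ** \<Lambda>) ` T"
  define T' where "T' = {y \<in> UNIV. \<forall>x\<in>T. orthogonal x y}"
  have T: "subspace T"
    unfolding T_def by (rule subspace_stiefel_tangent)
  have C: "subspace C"
    unfolding C_def by (rule linear_subspace_image[OF linear_matrix_mult_right T])
  have T': "subspace T'"
    unfolding T'_def subspace_def by (auto simp: orthogonal_def inner_simps)
  have mem: "(Q, S) \<in> stiefel_cotangent_bundle \<Lambda> \<longleftrightarrow> S \<in> C" for S
    using Q by (auto simp: stiefel_cotangent_bundle_def C_def T_def stiefel_tangent_def)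
  have triv: "X = 0" if "X \<in> T" "X ** \<Lambda> \<in> T'" for X
    using that positive_definite_diagonal_inner[OF \<Lambda>, of X]
    by (force simp: T'_def orthogonal_def inner_commute)
  have inj: "inj_on (\<lambda>X. X ** \<Lambda>) T"
    unfolding linear_inj_on_iff_eq_0[OF linear_matrix_mult_right T]
    using triv subspace_0[OF T'] by metis
  have dimC: "dim C = dim T"
    unfolding C_def using inj T linear_matrix_mult_right
    by (metis dim_image_eq span_eq_iff)
  have int: "C \<inter> T' = {0}"
    using triv subspace_0[OF T'] subspace_0[OF C] linear_0[OF linear_matrix_mult_right]
    by (fastforce simp: C_def)
  have dimT': "dim T' + dim T = DIM(real^'N^'n)"
    using dim_subspace_orthogonal_to_vectors[OF T subspace_UNIV subset_UNIV]
    unfolding T'_def by (metis dim_UNIV)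
  have "dim {x + y |x y. x \<in> C \<and> y \<in> T'} = DIM(real^'N^'n)"
    using dim_sums_Int[OF C T'] dimC dimT' int by simp
  hence "span {x + y |x y. x \<in> C \<and> y \<in> T'} = UNIV"
    by (rule dim_eq_full[THEN iffD1])
  moreover have "span {x + y |x y. x \<in> C \<and> y \<in> T'} = {x + y |x y. x \<in> C \<and> y \<in> T'}"
    by (rule span_eq_iff[THEN iffD2, OF subspace_sums[OF C T']])
  ultimately have sums: "{x + y |x y. x \<in> C \<and> y \<in> T'} = UNIV"
    by (rule trans[OF sym, rotated])
  define G where "G = adjoint \<phi> 1"
  have G: "\<phi> \<Gamma> = G \<bullet> \<Gamma>" for \<Gamma>
    using adjoint_works[OF \<phi>, of \<Gamma> 1] by (simp add: G_def inner_commute)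
  obtain S Y where SY: "S \<in> C" "Y \<in> T'" "G = S + Y"
    using sums by blast
  have repr: "\<forall>\<Gamma>\<in>T. \<phi> \<Gamma> = S \<bullet> \<Gamma>"
    using SY by (auto simp: G T'_def orthogonal_def inner_simps inner_commute)
  have uniq: "S' = S" if "S' \<in> C" "\<forall>\<Gamma>\<in>T. \<phi> \<Gamma> = S' \<bullet> \<Gamma>" for S'
  proof -
    have "S' - S \<in> T'"
      using that repr by (auto simp: T'_def orthogonal_def inner_simps inner_commute)
    moreover have "S' - S \<in> C"
      using that SY C by (simp add: subspace_diff)
    ultimately have "S' - S \<in> {0}"
      unfolding int[symmetric] by (rule IntI[rotated])
    thus ?thesis
      by simp
  qed
  show ?thesis
    unfolding mem trace_transpose_mult_inner T_def[symmetric]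
  proof (rule ex1I[of _ S])
    show "S \<in> C \<and> (\<forall>\<Gamma>\<in>T. \<phi> \<Gamma> = S \<bullet> \<Gamma>)"
      using SY(1) repr by (rule conjI)
    show "S' = S" if "S' \<in> C \<and> (\<forall>\<Gamma>\<in>T. \<phi> \<Gamma> = S' \<bullet> \<Gamma>)" for S'
      using conjunct1[OF that] conjunct2[OF that] by (rule uniq)
  qed
qed

end

theory Submission
  imports Defs
begin

text \<open>
  Put \<open>K = \<Lambda>\<^sup>-\<^sup>1\<close> and \<open>A = Q K Q\<^sup>T\<close>. The condition \<open>S = Q U \<Lambda>\<close> with \<open>U\<close> skew says exactly that
  \<open>S K\<close> is tangent at \<open>Q\<close>, i.e. \<open>Q K S\<^sup>T + S K Q\<^sup>T = 0\<close>; so both the cotangent bundle and \<open>W0\<close> (the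
  case \<open>K = 1\<close>) are zero sets of one quadratic submersion into pairs of symmetric matrices.
  Inverting \<open>M_map\<close> at \<open>(Q, P)\<close> amounts to finding the symmetric \<open>D\<close> for which \<open>S = P - D Q\<close> satisfies
  this condition, that is \<open>A D + D A = Q K P\<^sup>T + P K Q\<^sup>T\<close>. As \<open>A\<close> is positive definite, this
  Sylvester equation is uniquely solvable among all matrices as soon as \<open>Q Q\<^sup>T\<close> is invertible, and
  uniqueness forces \<open>D\<close> to be symmetric. By Cramer's rule the solution is smooth on that open set,
  which gives the smooth extension of the inverse.
\<close>

section \<open>Calculus of smooth maps\<close>

text \<open>A derivative depends only on values near the point, and openness keeps such a
  neighbourhood inside \<open>S\<close>. So agreement on \<open>S\<close> passes to all directional
  derivatives.\<close>

lemma times_differentiable_on_cong: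
  assumes "open S" "\<And>x. x \<in> S \<Longrightarrow> f x = g x" "times_differentiable_on k S f"
  shows "times_differentiable_on k S g"
  using assms(2,3)
proof (induction k arbitrary: f g)
  case 0
  then show ?case
    using continuous_on_cong[of S S f g] by simp
next
  case (Suc k)
  have der: "(g has_derivative frechet_derivative f (at x)) (at x)" if "x \<in> S" for x
  proof (rule has_derivative_transform_within_open[OF _ assms(1) that])
    show "(f has_derivative frechet_derivative f (at x)) (at x)"
      using Suc.prems(2) that frechet_derivative_works by auto
  qed (use Suc.prems(1) in auto)
  have "frechet_derivative f (at x) v = frechet_derivative g (at x) v" if "x \<in> S" for x v
    using frechet_derivative_at[OF der[OF that]] by simp
  then have "times_differentiable_on k S (\<lambda>x. frechet_derivative g (at x) v)" for v
    using Suc.IH[of "\<lambda>x. frechet_derivative f (at x) v" "\<lambda>x. frechet_derivative g (at x) v"]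
      Suc.prems(2) by simp
  then show ?case
    using der by (auto simp: differentiable_def)
qed

text \<open>By uniqueness of derivatives, an explicit formula \<open>f'\<close> may replace
  \<open>frechet_derivative\<close>. The calculus rules below are all proved through this
  introduction rule.\<close>

lemma times_differentiable_on_SucI:
  assumes "open S" "\<And>x. x \<in> S \<Longrightarrow> (f has_derivative f' x) (at x)"
    and "\<And>v. times_differentiable_on k S (\<lambda>x. f' x v)"
  shows "times_differentiable_on (Suc k) S f"
proof -
  have "f' x v = frechet_derivative f (at x) v" if "x \<in> S" for x v
    using frechet_derivative_at[OF assms(2)[OF that]] by simp
  then have "times_differentiable_on k S (\<lambda>x. frechet_derivative f (at x) v)" for v
    using times_differentiable_on_cong[OF assms(1) _ assms(3)[of v]] by simp
  then show ?thesis
    using assms(2) by (auto simp: differentiable_def)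
qed

lemma times_differentiable_on_Suc_has_derivative:
  assumes "times_differentiable_on (Suc k) S f" "x \<in> S"
  shows "(f has_derivative frechet_derivative f (at x)) (at x)"
  using assms frechet_derivative_works by auto

lemma times_differentiable_on_Suc_imp:
  assumes "times_differentiable_on (Suc k) S f"
  shows "times_differentiable_on k S f"
  using assms
proof (induction k arbitrary: f)
  case 0
  then show ?case
    by (auto intro!: continuous_at_imp_continuous_on differentiable_imp_continuous_within)
next
  case (Suc k)
  show ?case
    unfolding times_differentiable_on.simps(2)[of k]
  proof (intro conjI allI)
    fix v
    show "times_differentiable_on k S (\<lambda>x. frechet_derivative f (at x) v)"
      using Suc.prems by (intro Suc.IH) simp
  qed (use Suc.prems in simp)
qed

lemma times_differentiable_on_const:
  assumes "open S"
  shows "times_differentiable_on k S (\<lambda>x. c)"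
proof (induction k arbitrary: c)
  case (Suc k)
  show ?case
    by (rule times_differentiable_on_SucI[OF assms, where f' = "\<lambda>x v. 0"]) (auto intro: Suc)
qed simp

lemma times_differentiable_on_ident:
  assumes "open S"
  shows "times_differentiable_on k S (\<lambda>x. x)"
proof (cases k)
  case (Suc m)
  show ?thesis unfolding Suc
    by (rule times_differentiable_on_SucI[OF assms, where f' = "\<lambda>x v. v"])
      (auto intro: times_differentiable_on_const[OF assms])
qed simp

lemma times_differentiable_on_linear:
  assumes "open S" "bounded_linear h" "times_differentiable_on k S f"
  shows "times_differentiable_on k S (\<lambda>x. h (f x))"
  using assms(3)
proof (induction k arbitrary: f)
  case 0
  then show ?case
    using bounded_linear.continuous_on[OF assms(2)] by auto
next
  case (Suc k)
  show ?case
  proof (rule times_differentiable_on_SucI[OF assms(1),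
        where f' = "\<lambda>x v. h (frechet_derivative f (at x) v)"])
    show "((\<lambda>x. h (f x)) has_derivative (\<lambda>v. h (frechet_derivative f (at x) v))) (at x)"
      if "x \<in> S" for x
      using bounded_linear.has_derivative[OF assms(2)]
        times_differentiable_on_Suc_has_derivative[OF Suc.prems that] .
    show "times_differentiable_on k S (\<lambda>x. h (frechet_derivative f (at x) v))" for v
      using Suc.prems by (intro Suc.IH) simp
  qed
qed

lemma times_differentiable_on_add:
  assumes "open S" "times_differentiable_on k S f" "times_differentiable_on k S g"
  shows "times_differentiable_on k S (\<lambda>x. f x + g x)"
  using assms(2,3)
proof (induction k arbitrary: f g)
  case 0
  then show ?case by (auto intro: continuous_on_add)
next
  case (Suc k)
  show ?case
  proof (rule times_differentiable_on_SucI[OF assms(1), where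
        f' = "\<lambda>x v. frechet_derivative f (at x) v + frechet_derivative g (at x) v"])
    show "((\<lambda>x. f x + g x) has_derivative
        (\<lambda>v. frechet_derivative f (at x) v + frechet_derivative g (at x) v)) (at x)"
      if "x \<in> S" for x
      using Suc.prems[THEN times_differentiable_on_Suc_has_derivative, OF that]
      by (rule has_derivative_add)
    show "times_differentiable_on k S
        (\<lambda>x. frechet_derivative f (at x) v + frechet_derivative g (at x) v)" for v
      using Suc.prems by (intro Suc.IH) auto
  qed
qed

text \<open>The product rule leaves one factor undifferentiated in each summand. That factor is
  known at order \<open>Suc k\<close> and is lowered to order \<open>k\<close> before the induction
  hypothesis applies.\<close>

lemma times_differentiable_on_bilinear:
  fixes prod :: "'b::euclidean_space \<Rightarrow> 'c::euclidean_space \<Rightarrow> 'd::euclidean_space"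
  assumes "open S" "bounded_bilinear prod"
    and "times_differentiable_on k S f" "times_differentiable_on k S g"
  shows "times_differentiable_on k S (\<lambda>x. prod (f x) (g x))"
  using assms(3,4)
proof (induction k arbitrary: f g)
  case 0
  then show ?case
    using bounded_bilinear.continuous_on[OF assms(2)] by auto
next
  case (Suc k)
  show ?case
  proof (rule times_differentiable_on_SucI[OF assms(1), where f' = "\<lambda>x v.
        prod (f x) (frechet_derivative g (at x) v) + prod (frechet_derivative f (at x) v) (g x)"])
    show "((\<lambda>x. prod (f x) (g x)) has_derivative (\<lambda>v. prod (f x) (frechet_derivative g (at x) v)
        + prod (frechet_derivative f (at x) v) (g x))) (at x)" if "x \<in> S" for x
      using bounded_bilinear.FDERIV[OF assms(2)]
        Suc.prems[THEN times_differentiable_on_Suc_has_derivative, OF that] .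
    show "times_differentiable_on k S (\<lambda>x. prod (f x) (frechet_derivative g (at x) v)
        + prod (frechet_derivative f (at x) v) (g x))" for v
      using Suc.prems times_differentiable_on_Suc_imp[of k S f]
        times_differentiable_on_Suc_imp[of k S g]
      by (intro times_differentiable_on_add[OF assms(1)] Suc.IH) auto
  qed
qed

text \<open>The derivative of \<open>inverse (f x)\<close> contains \<open>inverse (f x)\<close>
  again, but only at order \<open>k\<close>, where the induction hypothesis supplies it.\<close>

lemma times_differentiable_on_inverse:
  fixes f :: "'a::euclidean_space \<Rightarrow> real"
  assumes "open S" "times_differentiable_on k S f" "\<And>x. x \<in> S \<Longrightarrow> f x \<noteq> 0"
  shows "times_differentiable_on k S (\<lambda>x. inverse (f x))"
  using assms(2)
proof (induction k)
  case 0
  then show ?case using assms(3) by (auto intro!: continuous_on_inverse)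
next
  case (Suc k)
  have inv: "times_differentiable_on k S (\<lambda>x. inverse (f x))"
    using Suc times_differentiable_on_Suc_imp by blast
  show ?case
  proof (rule times_differentiable_on_SucI[OF assms(1), where
        f' = "\<lambda>x v. - (inverse (f x) * frechet_derivative f (at x) v * inverse (f x))"])
    show "((\<lambda>x. inverse (f x)) has_derivative
        (\<lambda>v. - (inverse (f x) * frechet_derivative f (at x) v * inverse (f x)))) (at x)"
      if "x \<in> S" for x
      using assms(3)[OF that] times_differentiable_on_Suc_has_derivative[OF Suc.prems that]
      by (rule Deriv.has_derivative_inverse)
    have "times_differentiable_on k S
        (\<lambda>x. inverse (f x) * frechet_derivative f (at x) v * inverse (f x))" for v
      using Suc.prems inv
      by (intro times_differentiable_on_bilinear[OF assms(1) bounded_bilinear_mult]) auto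
    then show "times_differentiable_on k S
        (\<lambda>x. - (inverse (f x) * frechet_derivative f (at x) v * inverse (f x)))" for v
      by (intro times_differentiable_on_linear[OF assms(1), of uminus]
          bounded_linear_minus bounded_linear_ident)
  qed
qed

section \<open>Closure rules for smooth maps\<close>

lemma smooth_on_cong:
  "open S \<Longrightarrow> (\<And>x. x \<in> S \<Longrightarrow> f x = g x) \<Longrightarrow> smooth_on S f \<Longrightarrow> smooth_on S g"
  unfolding smooth_on_def using times_differentiable_on_cong by blast

lemma smooth_on_const: "open S \<Longrightarrow> smooth_on S (\<lambda>x. c)"
  by (simp add: smooth_on_def times_differentiable_on_const)

lemma smooth_on_ident: "open S \<Longrightarrow> smooth_on S (\<lambda>x. x)"
  by (simp add: smooth_on_def times_differentiable_on_ident)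

lemma smooth_on_linear:
  "open S \<Longrightarrow> bounded_linear h \<Longrightarrow> smooth_on S f \<Longrightarrow> smooth_on S (\<lambda>x. h (f x))"
  by (simp add: smooth_on_def times_differentiable_on_linear)

lemma smooth_on_add:
  "open S \<Longrightarrow> smooth_on S f \<Longrightarrow> smooth_on S g \<Longrightarrow> smooth_on S (\<lambda>x. f x + g x)"
  by (simp add: smooth_on_def times_differentiable_on_add)

lemma smooth_on_bilinear:
  fixes prod :: "'b::euclidean_space \<Rightarrow> 'c::euclidean_space \<Rightarrow> 'd::euclidean_space"
  shows "open S \<Longrightarrow> bounded_bilinear prod \<Longrightarrow> smooth_on S f \<Longrightarrow> smooth_on S g \<Longrightarrow>
    smooth_on S (\<lambda>x. prod (f x) (g x))"
  by (simp add: smooth_on_def times_differentiable_on_bilinear)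

lemma smooth_on_inverse:
  fixes f :: "'a::euclidean_space \<Rightarrow> real"
  shows "open S \<Longrightarrow> smooth_on S f \<Longrightarrow> (\<And>x. x \<in> S \<Longrightarrow> f x \<noteq> 0) \<Longrightarrow>
    smooth_on S (\<lambda>x. inverse (f x))"
  by (simp add: smooth_on_def times_differentiable_on_inverse)

lemma smooth_on_uminus: "open S \<Longrightarrow> smooth_on S f \<Longrightarrow> smooth_on S (\<lambda>x. - f x)"
  by (rule smooth_on_linear[of S uminus]) (auto intro: bounded_linear_minus bounded_linear_ident)

lemma smooth_on_diff:
  "open S \<Longrightarrow> smooth_on S f \<Longrightarrow> smooth_on S g \<Longrightarrow> smooth_on S (\<lambda>x. f x - g x)"
  using smooth_on_add[of S f "\<lambda>x. - g x"] by (simp add: smooth_on_uminus)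

lemma smooth_on_sum:
  "open S \<Longrightarrow> (\<And>i. i \<in> I \<Longrightarrow> smooth_on S (f i)) \<Longrightarrow> smooth_on S (\<lambda>x. \<Sum>i\<in>I. f i x)"
  by (induction I rule: infinite_finite_induct) (auto intro: smooth_on_const smooth_on_add)

lemma smooth_on_prod:
  fixes f :: "'i \<Rightarrow> 'a::euclidean_space \<Rightarrow> real"
  shows "open S \<Longrightarrow> (\<And>i. i \<in> I \<Longrightarrow> smooth_on S (f i)) \<Longrightarrow> smooth_on S (\<lambda>x. \<Prod>i\<in>I. f i x)"
  by (induction I rule: infinite_finite_induct)
    (auto intro: smooth_on_const smooth_on_bilinear[OF _ bounded_bilinear_mult])

lemma smooth_on_Pair:
  assumes "open S" "smooth_on S f" "smooth_on S g"
  shows "smooth_on S (\<lambda>x. (f x, g x))"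
proof -
  have "smooth_on S (\<lambda>x. (f x, 0) + (0, g x))"
    using assms bounded_linear_Pair[OF bounded_linear_ident bounded_linear_zero]
      bounded_linear_Pair[OF bounded_linear_zero bounded_linear_ident]
    by (intro smooth_on_add smooth_on_linear[of S "\<lambda>y. (y, 0)"]
        smooth_on_linear[of S "\<lambda>y. (0, y)"]) auto
  then show ?thesis by simp
qed

lemma smooth_on_vec:
  fixes f :: "'a::euclidean_space \<Rightarrow> real^'m"
  assumes "open S" "\<And>i. smooth_on S (\<lambda>x. f x $ i)"
  shows "smooth_on S f"
proof -
  have "smooth_on S (\<lambda>x. \<Sum>i\<in>UNIV. f x $ i *\<^sub>R (axis i 1 :: real^'m))"
    using assms by (intro smooth_on_sum smooth_on_linear[OF _ bounded_linear_scaleR_left]) auto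
  moreover have "(\<Sum>i\<in>UNIV. f x $ i *\<^sub>R (axis i 1 :: real^'m)) = f x" for x
    by (simp add: vec_eq_iff axis_def if_distrib cong: if_cong)
  ultimately show ?thesis by simp
qed

lemma smooth_on_det:
  fixes A :: "'a::euclidean_space \<Rightarrow> real^'m^'m"
  assumes "open S" "\<And>i j. smooth_on S (\<lambda>x. A x $ i $ j)"
  shows "smooth_on S (\<lambda>x. det (A x))"
  unfolding det_def using assms
  by (intro smooth_on_sum smooth_on_bilinear[OF _ bounded_bilinear_mult] smooth_on_prod
      smooth_on_const) auto

lemma smooth_on_continuous: "smooth_on S f \<Longrightarrow> continuous_on S f"
  unfolding smooth_on_def by (metis times_differentiable_on.simps(1))

text \<open>Cramer's rule makes each coordinate of \<open>y\<close> a quotient of determinants,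
  which are polynomials in smooth entries; the denominator has no zero on \<open>S\<close>.\<close>

lemma smooth_on_linear_system:
  fixes A :: "'a::euclidean_space \<Rightarrow> real^'m^'m"
  assumes "open S" and A: "\<And>i j. smooth_on S (\<lambda>x. A x $ i $ j)"
    and b: "\<And>i. smooth_on S (\<lambda>x. b x $ i)"
    and det: "\<And>x. x \<in> S \<Longrightarrow> det (A x) \<noteq> 0"
    and sol: "\<And>x. x \<in> S \<Longrightarrow> A x *v y x = b x"
  shows "smooth_on S y"
proof (rule smooth_on_vec[OF assms(1)])
  fix k
  \<comment> \<open>Column \<open>k\<close> of \<open>A x\<close> replaced by \<open>b x\<close>:
    the numerator in Cramer's rule.\<close>
  let ?B = "\<lambda>x. \<chi> i j. if j = k then b x $ i else A x $ i $ j"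
  have "smooth_on S (\<lambda>x. ?B x $ i $ j)" for i j
    using A b by (cases "j = k") simp_all
  then have "smooth_on S (\<lambda>x. det (?B x) * inverse (det (A x)))"
    using A det by (intro smooth_on_bilinear[OF _ bounded_bilinear_mult] smooth_on_inverse
        smooth_on_det assms(1))
  then show "smooth_on S (\<lambda>x. y x $ k)"
  proof (rule smooth_on_cong[OF assms(1), rotated])
    show "det (?B x) * inverse (det (A x)) = y x $ k" if "x \<in> S" for x
      using cramer[OF det[OF that], of "y x" "b x"] sol[OF that]
      by (simp add: vec_eq_iff divide_inverse)
  qed
qed

text \<open>The coordinate-free form for operators on a matrix space, as needed for
  \<open>J_hat\<close>. Smoothness of \<open>L x v\<close> for each fixed \<open>v\<close> gives
  smooth entries of the representing matrix, and injectivity gives its nonzero determinant.\<close>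

lemma smooth_on_linear_solution:
  fixes L :: "'a::euclidean_space \<Rightarrow> real^'n^'m \<Rightarrow> real^'n^'m"
  assumes "open S" and lin: "\<And>x. x \<in> S \<Longrightarrow> linear (L x)" and inj: "\<And>x. x \<in> S \<Longrightarrow> inj (L x)"
    and L: "\<And>v. smooth_on S (\<lambda>x. L x v)" and b: "smooth_on S b"
    and sol: "\<And>x. x \<in> S \<Longrightarrow> L x (y x) = b x"
  shows "smooth_on S y"
proof -
  \<comment> \<open>\<open>h\<close> flattens a matrix to a vector indexed by pairs and
    \<open>u\<close> undoes it, so that \<open>L x\<close> becomes a square matrix acting on
    vectors.\<close>
  define h :: "real^'n^'m \<Rightarrow> real^('m \<times> 'n)" where "h X = (\<chi> p. X $ fst p $ snd p)" for X
  define u :: "real^('m \<times> 'n) \<Rightarrow> real^'n^'m" where "u v = (\<chi> i j. v $ (i, j))" for v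
  have hu: "h (u v) = v" and uh: "u (h X) = X" for v X
    by (simp_all add: h_def u_def vec_eq_iff)
  have h: "bounded_linear h" and u: "bounded_linear u"
    by (auto simp: linear_conv_bounded_linear[symmetric] h_def u_def vec_eq_iff intro!: linearI)
  define A where "A x = matrix (\<lambda>v. h (L x (u v)))" for x
  have linA: "linear (\<lambda>v. h (L x (u v)))" if "x \<in> S" for x
    using linear_compose[OF linear_compose[OF bounded_linear.linear[OF u] lin[OF that]]
        bounded_linear.linear[OF h]] by (simp add: o_def)
  have Av: "A x *v v = h (L x (u v))" if "x \<in> S" for x v
    unfolding A_def using matrix_works[OF linear_matrix_vector_mul_eq[THEN iffD2, OF linA[OF that]]] .
  have comp: "bounded_linear (\<lambda>v. v $ i)" for i :: "'m \<times> 'n"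
    by (rule bounded_linear_vec_nth)
  have "smooth_on S (\<lambda>x. h (y x))"
  proof (rule smooth_on_linear_system[OF assms(1), where A = A and b = "\<lambda>x. h (b x)"])
    show "smooth_on S (\<lambda>x. A x $ i $ j)" for i j
      unfolding A_def matrix_def using L assms(1)
      by (auto intro!: smooth_on_linear[OF _ comp] smooth_on_linear[OF _ h])
    show "smooth_on S (\<lambda>x. h (b x) $ i)" for i
      using b assms(1) by (auto intro!: smooth_on_linear[OF _ comp] smooth_on_linear[OF _ h])
    show "det (A x) \<noteq> 0" if "x \<in> S" for x
    proof -
      have "inj ((*v) (A x))"
      proof (rule injI)
        fix v w assume "A x *v v = A x *v w"
        then show "v = w"
          using Av[OF that] inj[OF that] by (metis hu uh injD)
      qed
      then show ?thesis
        using matrix_left_invertible_injective invertible_left_inverse invertible_det_nz by blast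
    qed
    show "A x *v h (y x) = h (b x)" if "x \<in> S" for x
      using that by (simp add: Av uh sol)
  qed
  from smooth_on_linear[OF assms(1) u this] show ?thesis
    by (simp add: uh)
qed


section \<open>Real matrices\<close>

lemma bounded_bilinear_matrix_mult:
  "bounded_bilinear ((**) :: real^'k^'m \<Rightarrow> real^'n^'k \<Rightarrow> real^'n^'m)"
  unfolding bilinear_conv_bounded_bilinear[symmetric] bilinear_def
  by (simp add: linear_matrix_mult_left linear_matrix_mult_right)

lemma bounded_linear_transpose: "bounded_linear (transpose :: real^'m^'n \<Rightarrow> real^'n^'m)"
  by (auto simp: linear_conv_bounded_linear[symmetric] transpose_def vec_eq_iff intro!: linearI)

text \<open>Normal form: sums of right-nested products. Cancellation facts used alongside, such as
  \<open>QQ\<close> and \<open>skew'\<close> below, therefore carry an arbitrary trailing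
  factor.\<close>

lemmas matrix_mult_simps =
  bounded_bilinear.add_left[OF bounded_bilinear_matrix_mult]
  bounded_bilinear.add_right[OF bounded_bilinear_matrix_mult]
  bounded_bilinear.diff_left[OF bounded_bilinear_matrix_mult]
  bounded_bilinear.diff_right[OF bounded_bilinear_matrix_mult]
  bounded_bilinear.minus_left[OF bounded_bilinear_matrix_mult]
  bounded_bilinear.minus_right[OF bounded_bilinear_matrix_mult]
  bounded_bilinear.scaleR_left[OF bounded_bilinear_matrix_mult]
  bounded_bilinear.scaleR_right[OF bounded_bilinear_matrix_mult]
  bounded_bilinear.zero_left[OF bounded_bilinear_matrix_mult]
  bounded_bilinear.zero_right[OF bounded_bilinear_matrix_mult]
  matrix_mul_assoc[symmetric]

lemmas transpose_simps =
  linear_add[OF bounded_linear.linear[OF bounded_linear_transpose]]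
  linear_diff[OF bounded_linear.linear[OF bounded_linear_transpose]]
  linear_neg[OF bounded_linear.linear[OF bounded_linear_transpose]]
  linear_0[OF bounded_linear.linear[OF bounded_linear_transpose]]
  transpose_scalar matrix_transpose_mul

lemma inner_transpose:
  fixes X Y :: "real^'m^'n"
  shows "transpose X \<bullet> transpose Y = X \<bullet> Y"
  unfolding inner_vec_def transpose_def
  by (simp add: sum.swap[of _ "UNIV :: 'm set"])

text \<open>The inner product is the sum of the quadratic form of \<open>A\<close> over the rows of
  \<open>X\<close>, and some row is nonzero.\<close>

lemma positive_definite_inner:
  fixes X :: "real^'m^'n"
  assumes "positive_definite A" "X \<noteq> 0"
  shows "(X ** A) \<bullet> X > 0"
proof -
  have sym: "A $ i $ j = A $ j $ i" for i j
    using assms(1) unfolding positive_definite_def transpose_def by (metis vec_lambda_beta)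
  have row: "(X ** A) $ i = A *v (X $ i)" for i
    by (simp add: vec_eq_iff matrix_matrix_mult_def matrix_vector_mult_def sym mult.commute)
  obtain i where i: "X $ i \<noteq> 0"
    using assms(2) by (auto simp: vec_eq_iff)
  have "0 \<le> (X ** A) $ j \<bullet> X $ j" for j
    using assms(1) unfolding row positive_definite_def
    by (cases "X $ j = 0") (auto simp: inner_commute less_imp_le)
  moreover have "0 < (X ** A) $ i \<bullet> X $ i"
    using assms(1) i unfolding row positive_definite_def by (auto simp: inner_commute)
  ultimately show ?thesis
    unfolding inner_vec_def[of "X ** A"] by (intro sum_pos2[of UNIV i]) auto
qed

text \<open>Pair the equation with \<open>X\<close>. The term \<open>(X ** A) \<bullet> X\<close>
  and, after transposing, the term \<open>(A ** X) \<bullet> X\<close> are both values of the form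
  in \<open>positive_definite_inner\<close>, so their sum vanishes only for
  \<open>X = 0\<close>.\<close>

lemma positive_definite_sylvester_unique:
  fixes A :: "real^'n^'n"
  assumes A: "positive_definite A" and X: "A ** X + X ** A = 0"
  shows "X = 0"
proof (rule ccontr)
  assume "X \<noteq> 0"
  moreover have "transpose X \<noteq> 0"
    using \<open>X \<noteq> 0\<close> by (metis transpose_simps(4) transpose_transpose)
  ultimately have "(X ** A) \<bullet> X + (transpose X ** A) \<bullet> transpose X > 0"
    using positive_definite_inner[OF A] add_pos_pos by blast
  moreover have "(transpose X ** A) \<bullet> transpose X = (A ** X) \<bullet> X"
    using A inner_transpose[of "A ** X" X]
    by (simp add: positive_definite_def transpose_simps)
  ultimately have "(A ** X + X ** A) \<bullet> X > 0"
    by (simp add: inner_add_left)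
  then show False
    by (simp add: X)
qed

lemma positive_definite_invertible:
  assumes "positive_definite A"
  shows "invertible A"
proof -
  have "x = 0" if "A *v x = 0" for x
    using assms that unfolding positive_definite_def by (metis inner_zero_right less_irrefl)
  then show ?thesis
    using matrix_left_invertible_ker invertible_left_inverse by blast
qed

lemma invertible_matrix_inv:
  fixes A :: "real^'n^'n"
  assumes "invertible A"
  shows "A ** matrix_inv A = mat 1" "matrix_inv A ** A = mat 1"
  using assms someI_ex[of "\<lambda>B. A ** B = mat 1 \<and> B ** A = mat 1"]
  unfolding invertible_def matrix_inv_def by auto

text \<open>With \<open>y = matrix_inv A *v x\<close> one has \<open>x = A *v y\<close>, so the form
  of the inverse at \<open>x\<close> equals the form of \<open>A\<close> at
  \<open>y\<close>.\<close>

lemma positive_definite_matrix_inv: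
  assumes "positive_definite A"
  shows "positive_definite (matrix_inv A)"
proof -
  let ?K = "matrix_inv A"
  note inv = invertible_matrix_inv[OF positive_definite_invertible[OF assms]]
  have sym: "transpose A = A"
    using assms by (simp add: positive_definite_def)
  have "transpose ?K = transpose ?K ** (A ** ?K)"
    by (simp add: inv)
  also have "\<dots> = transpose (A ** ?K) ** ?K"
    by (simp add: transpose_simps sym matrix_mul_assoc)
  finally have "transpose ?K = ?K"
    by (simp add: inv)
  moreover have "x \<bullet> (?K *v x) > 0" if "x \<noteq> 0" for x
  proof -
    have x: "A *v (?K *v x) = x"
      by (simp add: matrix_vector_mul_assoc inv)
    then have "?K *v x \<noteq> 0"
      using that by auto
    then have "(?K *v x) \<bullet> (A *v (?K *v x)) > 0"
      using assms unfolding positive_definite_def by blast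
    then show ?thesis
      by (simp only: x inner_commute)
  qed
  ultimately show ?thesis
    by (simp add: positive_definite_def)
qed

text \<open>The form at \<open>x\<close> is that of \<open>K\<close> at
  \<open>transpose Q *v x\<close>, which is nonzero because \<open>Q ** transpose Q\<close> is
  invertible. The determinant condition is open in \<open>Q\<close>, as the smooth extension of the
  inverse map requires.\<close>

lemma positive_definite_congruence:
  fixes Q :: "real^'m^'n"
  assumes K: "positive_definite K" and det: "det (Q ** transpose Q) \<noteq> 0"
  shows "positive_definite (Q ** K ** transpose Q)"
proof -
  have "x \<bullet> ((Q ** K ** transpose Q) *v x) > 0" if "x \<noteq> 0" for x
  proof -
    have "transpose Q *v x \<noteq> 0"
    proof
      assume "transpose Q *v x = 0"
      then have "(Q ** transpose Q) *v x = 0"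
        by (metis matrix_vector_mul_assoc matrix_vector_mult_0_right)
      then show False
        using that det matrix_left_invertible_ker[of "Q ** transpose Q"]
        by (metis invertible_det_nz invertible_left_inverse)
    qed
    then have "(transpose Q *v x) \<bullet> (K *v (transpose Q *v x)) > 0"
      using K unfolding positive_definite_def by blast
    also have "(transpose Q *v x) \<bullet> (K *v (transpose Q *v x)) = x \<bullet> ((Q ** K ** transpose Q) *v x)"
      by (metis dot_lmul_matrix matrix_vector_mul_assoc transpose_matrix_vector)
    finally show ?thesis .
  qed
  then show ?thesis
    using K by (simp add: positive_definite_def transpose_simps matrix_mul_assoc)
qed


section \<open>The cotangent bundle and \<open>W0\<close> as submanifolds\<close>

definition weighted_pairs :: "real^'N^'N \<Rightarrow> ((real^'N^'n) \<times> (real^'N^'n)) set" where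
  "weighted_pairs K = {(Q, S). Q ** transpose Q = mat 1 \<and>
     Q ** K ** transpose S + S ** K ** transpose Q = 0}"

lemma W0_eq_weighted_pairs: "W0 = weighted_pairs (mat 1)"
  by (simp add: W0_def weighted_pairs_def)

lemma stiefel_cotangent_bundle_eq_weighted_pairs:
  fixes \<Lambda> :: "real^'m^'m"
  assumes \<Lambda>: "transpose \<Lambda> = \<Lambda>" and K: "transpose K = K"
    and inv: "\<Lambda> ** K = mat 1" "K ** \<Lambda> = mat 1"
  shows "(stiefel_cotangent_bundle \<Lambda> :: ((real^'m^'n) \<times> (real^'m^'n)) set) = weighted_pairs K"
proof -
  have inv': "\<Lambda> ** (K ** X) = X" "K ** (\<Lambda> ** X) = X" for X :: "real^'k^'m"
    using inv by (simp_all add: matrix_mul_assoc)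
  have "(Q, S) \<in> weighted_pairs K"
    if "Q ** transpose Q = mat 1" "transpose U = - U" "S = Q ** U ** \<Lambda>"
    for Q S :: "real^'m^'n" and U
    using that by (simp add: weighted_pairs_def transpose_simps matrix_mult_simps \<Lambda> inv')
  moreover have "\<exists>U\<in>so. S = Q ** U ** \<Lambda>" if "(Q, S) \<in> weighted_pairs K"
    for Q S :: "real^'m^'n"
  proof
    have Q: "Q ** transpose Q = mat 1" and S: "Q ** K ** transpose S + S ** K ** transpose Q = 0"
      using that by (auto simp: weighted_pairs_def)
    let ?X = "S ** K"
    \<comment> \<open>Here \<open>?X ** transpose Q\<close> is skew, by the defining equation and
      symmetry of \<open>K\<close>. The first two terms of \<open>?U\<close> form a skew matrix with
      \<open>Q\<close>-image
      \<open>?X - Q ** transpose ?X ** Q = ?X + ?X ** transpose Q ** Q\<close>. The third term is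
      skew too and removes the excess.\<close>
    let ?U = "transpose Q ** ?X - transpose ?X ** Q - transpose Q ** ?X ** transpose Q ** Q"
    have QQ: "Q ** (transpose Q ** Y) = Y" for Y :: "real^'k^'n"
      using Q by (simp add: matrix_mul_assoc)
    have skew: "Q ** (K ** transpose S) = - (S ** (K ** transpose Q))"
      using S by (simp add: matrix_mul_assoc eq_neg_iff_add_eq_0)
    have skew': "Q ** (K ** (transpose S ** Y)) = - (S ** (K ** (transpose Q ** Y)))"
      for Y :: "real^'k^'n"
      using arg_cong[OF skew, of "\<lambda>Z. Z ** Y"] by (simp add: matrix_mult_simps)
    show "?U \<in> so"
      by (simp add: so_def transpose_simps matrix_mult_simps K skew')
    have "Q ** ?U = ?X"
      by (simp add: matrix_mult_simps transpose_simps K QQ skew')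
    then show "S = Q ** ?U ** \<Lambda>"
      by (simp add: inv matrix_mul_assoc[symmetric])
  qed
  ultimately show ?thesis
    unfolding stiefel_cotangent_bundle_def stiefel_def so_def
    by (auto simp: weighted_pairs_def)
qed

text \<open>Zero is a regular value of the defining equations with values in pairs of symmetric
  matrices: symmetry of \<open>K\<close> keeps the values there, and the left inverse
  \<open>L\<close> of \<open>K\<close> makes the derivative onto.\<close>

lemma smooth_submanifold_weighted_pairs:
  fixes K L :: "real^'N^'N"
  assumes K: "transpose K = K" and LK: "L ** K = mat 1"
  shows "\<exists>k. smooth_submanifold k (weighted_pairs K :: ((real^'N^'n) \<times> (real^'N^'n)) set)"
proof -
  define Sym :: "(real^'n^'n) set" where "Sym = {Z. transpose Z = Z}"
  have Sym: "subspace Sym"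
    by (auto simp: subspace_def Sym_def transpose_simps)
  have half: "(1/2) *\<^sub>R Z + (1/2) *\<^sub>R Z = Z" for Z :: "real^'n^'n"
    by (simp flip: scaleR_left_distrib)
  let ?X = "weighted_pairs K :: ((real^'N^'n) \<times> (real^'N^'n)) set"
  \<comment> \<open>The subtraction does not truncate: \<open>Sym \<times> Sym\<close> embeds into
    the ambient space, so its dimension is at most the ambient one.\<close>
  let ?k = "DIM((real^'N^'n) \<times> (real^'N^'n)) - dim (Sym \<times> Sym)"
  have "smooth_submanifold ?k ?X"
    unfolding smooth_submanifold_def
  proof
    fix p :: "(real^'N^'n) \<times> (real^'N^'n)" assume p: "p \<in> ?X"
    define Q\<^sub>0 where "Q\<^sub>0 = fst p"
    have Q\<^sub>0: "Q\<^sub>0 ** transpose Q\<^sub>0 = mat 1"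
      using p by (auto simp: Q\<^sub>0_def weighted_pairs_def)
    have cancel: "Z = Z'" if "Z ** Q\<^sub>0 = Z' ** Q\<^sub>0" for Z Z' :: "real^'n^'n"
      using arg_cong[OF that, of "\<lambda>Y. Y ** transpose Q\<^sub>0"] by (simp add: matrix_mul_assoc[symmetric] Q\<^sub>0)
    \<comment> \<open>Right multiplication by \<open>Q\<^sub>0\<close> embeds the target of the submersion into the ambient space,
      as the definition of a submanifold requires.\<close>
    define e :: "(real^'n^'n) \<times> (real^'n^'n) \<Rightarrow> (real^'N^'n) \<times> (real^'N^'n)"
      where "e Z = (fst Z ** Q\<^sub>0, snd Z ** Q\<^sub>0)" for Z
    define h :: "(real^'N^'n) \<times> (real^'N^'n) \<Rightarrow> (real^'n^'n) \<times> (real^'n^'n)"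
      where "h x = (fst x ** transpose (fst x) - mat 1,
        fst x ** (K ** transpose (snd x)) + snd x ** (K ** transpose (fst x)))" for x
    define h' :: "_ \<Rightarrow> (real^'N^'n) \<times> (real^'N^'n) \<Rightarrow> (real^'n^'n) \<times> (real^'n^'n)"
      where "h' x v = (fst x ** transpose (fst v) + fst v ** transpose (fst x),
        (fst x ** (K ** transpose (snd v)) + fst v ** (K ** transpose (snd x)))
        + (snd x ** (K ** transpose (fst v)) + snd v ** (K ** transpose (fst x))))"
      for x :: "(real^'N^'n) \<times> (real^'N^'n)" and v
    have e: "linear e"
      by (rule linearI) (auto simp: e_def matrix_mult_simps)
    have inj: "inj e"
      by (auto simp: e_def inj_def prod_eq_iff dest: cancel)
    have h_Sym: "h x \<in> Sym \<times> Sym" for x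
      by (simp add: h_def Sym_def transpose_simps K matrix_mult_simps add.commute)
    have h'_Sym: "h' x v \<in> Sym \<times> Sym" for x v
      by (simp add: h'_def Sym_def transpose_simps K matrix_mult_simps add_ac)
    have der: "((\<lambda>x. e (h x)) has_derivative (\<lambda>v. e (h' x v))) (at x)" for x
    proof (rule bounded_linear.has_derivative[of e])
      show "bounded_linear e"
        using e by (simp add: linear_conv_bounded_linear)
      note intros = bounded_bilinear.FDERIV[OF bounded_bilinear_matrix_mult]
        bounded_linear.has_derivative[OF bounded_linear_transpose] derivative_intros
      have "((\<lambda>x. fst x ** transpose (fst x) - mat 1) has_derivative (\<lambda>v. fst (h' x v))) (at x)"
        unfolding h'_def by (rule has_derivative_eq_rhs, (rule intros)+) simp
      moreover have "((\<lambda>x. fst x ** (K ** transpose (snd x)) + snd x ** (K ** transpose (fst x)))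
          has_derivative (\<lambda>v. snd (h' x v))) (at x)"
        unfolding h'_def by (rule has_derivative_eq_rhs, (rule intros)+)
          (simp add: matrix_mult_simps)
      ultimately show "(h has_derivative h' x) (at x)"
        using has_derivative_Pair unfolding h_def by fastforce
    qed
    have onto: "\<exists>v. h' x v = Z" if "x \<in> ?X" "Z \<in> Sym \<times> Sym" for x Z
    proof -
      obtain Q S where x: "x = (Q, S)" by (cases x)
      obtain Y Z' where Z: "Z = (Y, Z')" by (cases Z)
      have YZ: "transpose Y = Y" "transpose Z' = Z'"
        using that by (auto simp: Z Sym_def)
      have Q: "Q ** transpose Q = mat 1"
        using that by (auto simp: x weighted_pairs_def)
      have QQ: "Q ** (transpose Q ** M) = M" for M :: "real^'n^'n"
        using Q by (simp add: matrix_mul_assoc)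
      \<comment> \<open>For symmetric \<open>Y\<close> this solves the linearized orthonormality
        equation \<open>Q ** transpose q + q ** transpose Q = Y\<close>.\<close>
      define q where "q = (1/2) *\<^sub>R (Y ** Q)"
      define R where "R = q ** (K ** transpose S) + S ** (K ** transpose q)"
      have R: "transpose R = R"
        by (simp add: R_def transpose_simps K matrix_mult_simps add.commute)
      \<comment> \<open>\<open>R\<close> is what \<open>q\<close> already contributes to the second
        component. The remainder \<open>Z' - R\<close> is symmetric, so \<open>s\<close> is chosen
        such that \<open>s ** K ** transpose Q\<close> is half of it; the transposed term supplies
        the other half.\<close>
      define s where "s = (1/2) *\<^sub>R ((Z' - R) ** (Q ** L))"
      have s: "s ** (K ** transpose Q) = (1/2) *\<^sub>R (Z' - R)"
      proof -
        have "s ** (K ** transpose Q) = (1/2) *\<^sub>R ((Z' - R) ** (Q ** ((L ** K) ** transpose Q)))"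
          by (simp add: s_def matrix_mult_simps)
        then show ?thesis by (simp add: LK Q)
      qed
      have s': "Q ** (K ** transpose s) = (1/2) *\<^sub>R (Z' - R)"
        using arg_cong[OF s, of transpose]
        by (simp add: transpose_simps K R YZ matrix_mult_simps)
      have "Q ** transpose q + q ** transpose Q = Y"
        by (simp add: q_def transpose_simps YZ matrix_mult_simps Q QQ half)
      moreover have "(Q ** (K ** transpose s) + q ** (K ** transpose S))
          + (S ** (K ** transpose q) + s ** (K ** transpose Q)) = Z'"
      proof -
        have "(Q ** (K ** transpose s) + q ** (K ** transpose S))
            + (S ** (K ** transpose q) + s ** (K ** transpose Q))
          = ((1/2) *\<^sub>R (Z' - R) + (1/2) *\<^sub>R (Z' - R)) + R"
          unfolding s s' by (simp add: R_def)
        then show ?thesis by (simp add: half)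
      qed
      ultimately have "h' x (q, s) = Z"
        by (simp add: h'_def x Z)
      then show ?thesis by blast
    qed
    have "smooth_on UNIV (\<lambda>x. e (h x))"
    proof (rule smooth_on_linear[OF open_UNIV, of e h])
      show "bounded_linear e"
        using e by (simp add: linear_conv_bounded_linear)
      show "smooth_on UNIV h"
        unfolding h_def[abs_def]
        by (intro smooth_on_Pair smooth_on_add smooth_on_diff smooth_on_const open_UNIV
            smooth_on_bilinear[OF _ bounded_bilinear_matrix_mult]
            smooth_on_linear[OF _ bounded_linear_transpose]
            smooth_on_linear[OF _ bounded_linear_fst]
            smooth_on_linear[OF _ bounded_linear_snd] smooth_on_ident)
    qed
    moreover have "range (frechet_derivative (\<lambda>x. e (h x)) (at x)) = e ` (Sym \<times> Sym)"
      if "x \<in> ?X" for x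
    proof -
      have "range (h' x) = Sym \<times> Sym"
      proof (intro equalityI subsetI)
        show "Z \<in> range (h' x)" if "Z \<in> Sym \<times> Sym" for Z
          using onto[OF \<open>x \<in> ?X\<close> that] by (metis rangeI)
      qed (use h'_Sym in \<open>elim rangeE, simp only:\<close>)
      moreover have "range (\<lambda>v. e (h' x v)) = e ` range (h' x)"
        by (rule image_image[symmetric])
      ultimately show ?thesis
        by (simp only: frechet_derivative_at[OF der, symmetric])
    qed
    moreover have "?X \<inter> UNIV = {x \<in> UNIV. e (h x) = 0}"
    proof -
      have "e (h x) = 0 \<longleftrightarrow> h x = 0" for x
        using injD[OF inj, of "h x" 0] linear_0[OF e] by auto
      then show ?thesis
        by (auto simp: weighted_pairs_def h_def prod_eq_iff matrix_mult_simps)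
    qed
    moreover have "dim (e ` (Sym \<times> Sym)) + ?k = DIM((real^'N^'n) \<times> (real^'N^'n))"
    proof -
      have "dim (e ` (Sym \<times> Sym)) = dim (Sym \<times> Sym)"
        using dim_image_eq[OF e] inj inj_on_subset by blast
      then show ?thesis
        using dim_subset_UNIV[of "e ` (Sym \<times> Sym)"] by linarith
    qed
    moreover have "subspace (e ` (Sym \<times> Sym))"
      using linear_subspace_image[OF e subspace_Times[OF Sym Sym]] .
    moreover have "(\<lambda>x. e (h x)) ` UNIV \<subseteq> e ` (Sym \<times> Sym)"
      by (intro image_mono image_subsetI imageI h_Sym)
    ultimately show "\<exists>W F (g :: _ \<Rightarrow> (real^'N^'n) \<times> (real^'N^'n)).
        open W \<and> p \<in> W \<and> subspace F \<and> dim F + ?k = DIM((real^'N^'n) \<times> (real^'N^'n)) \<and>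
        smooth_on W g \<and> g ` W \<subseteq> F \<and> ?X \<inter> W = {x \<in> W. g x = 0} \<and>
        (\<forall>x\<in>?X \<inter> W. range (frechet_derivative g (at x)) = F)"
      by (intro exI[of _ UNIV] exI[of _ "e ` (Sym \<times> Sym)"] exI[of _ "\<lambda>x. e (h x)"] conjI ballI)
        simp_all
  qed
  then show ?thesis by blast
qed


section \<open>The symmetric Sylvester equation and the inverse map\<close>

lemma linear_J_hat: "linear (J_hat \<Lambda> Q)"
  by (rule linearI) (simp_all add: J_hat_def matrix_mult_simps scaleR_right_distrib)

lemma inj_J_hat:
  assumes "positive_definite (Q ** matrix_inv \<Lambda> ** transpose Q)"
  shows "inj (J_hat \<Lambda> Q)"
  unfolding linear_injective_0[OF linear_J_hat] J_hat_def
  using positive_definite_sylvester_unique[OF assms] by blast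

lemma surj_J_hat:
  assumes "positive_definite (Q ** matrix_inv \<Lambda> ** transpose Q)"
  shows "surj (J_hat \<Lambda> Q)"
  by (rule linear_injective_imp_surjective[OF linear_J_hat inj_J_hat[OF assms] refl])

text \<open>Together with injectivity this transfers symmetry or skewness of a right-hand side to
  the solution.\<close>

lemma transpose_J_hat:
  assumes "positive_definite (Q ** matrix_inv \<Lambda> ** transpose Q)"
  shows "transpose (J_hat \<Lambda> Q X) = J_hat \<Lambda> Q (transpose X)"
proof -
  have "transpose (Q ** matrix_inv \<Lambda> ** transpose Q) = Q ** matrix_inv \<Lambda> ** transpose Q"
    using assms unfolding positive_definite_def by blast
  then show ?thesis
    unfolding J_hat_def transpose_simps(1) matrix_transpose_mul[of _ X] matrix_transpose_mul[of X]
    by (simp add: add.commute)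
qed

text \<open>Since \<open>J_hat\<close> commutes with transposition and negation and is injective,
  \<open>J_hat \<Lambda> Q X\<close> is skew exactly when \<open>X\<close> is. Bijectivity on all
  matrices thus restricts to \<open>so\<close>.\<close>

lemma bij_betw_J_hat_so:
  assumes "positive_definite (Q ** matrix_inv \<Lambda> ** transpose Q)"
  shows "bij_betw (J_hat \<Lambda> Q) so so"
proof -
  note inj = inj_J_hat[OF assms]
  have iff: "J_hat \<Lambda> Q X \<in> so \<longleftrightarrow> X \<in> so" for X
  proof -
    have "J_hat \<Lambda> Q X \<in> so \<longleftrightarrow> J_hat \<Lambda> Q (transpose X) = J_hat \<Lambda> Q (- X)"
      by (simp add: so_def transpose_J_hat[OF assms] linear_neg[OF linear_J_hat])
    then show ?thesis
      by (simp add: so_def inj_eq[OF inj])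
  qed
  have "Y \<in> J_hat \<Lambda> Q ` so" if "Y \<in> so" for Y
  proof -
    obtain X where "Y = J_hat \<Lambda> Q X"
      using surjD[OF surj_J_hat[OF assms]] by blast
    with that iff show ?thesis
      by blast
  qed
  with iff have "J_hat \<Lambda> Q ` so = so"
    by blast
  then show ?thesis
    using inj_on_subset[OF inj subset_UNIV] by (simp add: bij_betw_def)
qed

text \<open>\<open>R0_map\<close> has the form \<open>M - transpose M\<close>, because
  \<open>matrix_inv \<Lambda>\<close> and the inverse of
  \<open>Q ** matrix_inv \<Lambda> ** transpose Q\<close> are symmetric.\<close>

lemma R0_map_so:
  assumes K: "transpose (matrix_inv \<Lambda>) = matrix_inv \<Lambda>"
    and A: "positive_definite (Q ** matrix_inv \<Lambda> ** transpose Q)"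
  shows "R0_map \<Lambda> Q P \<in> so"
proof -
  have "transpose (matrix_inv (Q ** matrix_inv \<Lambda> ** transpose Q))
      = matrix_inv (Q ** matrix_inv \<Lambda> ** transpose Q)"
    using positive_definite_matrix_inv[OF A] by (simp add: positive_definite_def)
  then have "transpose (R0_map \<Lambda> Q P) = - R0_map \<Lambda> Q P"
    unfolding R0_map_def transpose_simps(2) matrix_transpose_mul[of _ "matrix_inv (Q ** _ ** _)"]
      matrix_transpose_mul[of "matrix_inv (Q ** _ ** _)"]
    by (simp add: matrix_transpose_mul K matrix_mul_assoc)
  then show ?thesis by (simp add: so_def)
qed

text \<open>With \<open>A = Q \<Lambda>\<^sup>-\<^sup>1 Q\<^sup>T\<close> and \<open>B = Q \<Lambda>\<^sup>-\<^sup>1 P\<^sup>T\<close>, the coefficient \<open>B A\<^sup>-\<^sup>1 - A Y\<close> in \<open>S_map\<close> solves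
  \<open>A D + D A = B + B\<^sup>T\<close> precisely because \<open>A Y + Y A = B A\<^sup>-\<^sup>1 - A\<^sup>-\<^sup>1 B\<^sup>T\<close>.\<close>

lemma S_map_eq:
  fixes Q :: "real^'m^'n"
  assumes K: "transpose (matrix_inv \<Lambda>) = matrix_inv \<Lambda>"
    and A: "positive_definite (Q ** matrix_inv \<Lambda> ** transpose Q)"
    and D: "J_hat \<Lambda> Q D = Q ** matrix_inv \<Lambda> ** transpose P + P ** matrix_inv \<Lambda> ** transpose Q"
  shows "S_map \<Lambda> Q P = P - D ** Q"
proof -
  define A where "A = Q ** matrix_inv \<Lambda> ** transpose Q"
  define B where "B = Q ** matrix_inv \<Lambda> ** transpose P"
  define Y where "Y = inv_into so (J_hat \<Lambda> Q) (R0_map \<Lambda> Q P)"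
  have BT: "P ** matrix_inv \<Lambda> ** transpose Q = transpose B"
    by (simp add: B_def matrix_transpose_mul K matrix_mul_assoc)
  note inv = invertible_matrix_inv[OF positive_definite_invertible[OF A, folded A_def]]
  have inv': "A ** (matrix_inv A ** X) = X" for X :: "real^'n^'n"
    using inv by (simp add: matrix_mul_assoc)
  have J: "J_hat \<Lambda> Q X = A ** X + X ** A" for X
    by (simp add: J_hat_def A_def)
  have R0: "R0_map \<Lambda> Q P = B ** matrix_inv A - matrix_inv A ** transpose B"
    by (simp only: R0_map_def A_def B_def BT[unfolded B_def])
  have "J_hat \<Lambda> Q Y = R0_map \<Lambda> Q P"
    unfolding Y_def using bij_betw_J_hat_so[OF A] R0_map_so[OF K A]
    by (simp add: bij_betw_def f_inv_into_f)
  then have Y: "A ** Y + Y ** A = B ** matrix_inv A - matrix_inv A ** transpose B"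
    by (simp only: J R0)
  \<comment> \<open>Multiplying by \<open>A\<close> from the left gives an expression for
    \<open>A ** (B ** matrix_inv A)\<close>, the one product in the Sylvester operator at
    \<open>B ** matrix_inv A - A ** Y\<close> that does not simplify by itself.\<close>
  have "A ** (A ** Y) + A ** (Y ** A) = A ** (B ** matrix_inv A) - transpose B"
    using arg_cong[OF Y, of "\<lambda>Z. A ** Z"] by (simp add: matrix_mult_simps inv')
  then have "A ** (B ** matrix_inv A) = A ** (A ** Y) + A ** (Y ** A) + transpose B"
    by (simp add: algebra_simps)
  then have "J_hat \<Lambda> Q (B ** matrix_inv A - A ** Y) = B + transpose B"
    by (simp add: J matrix_mult_simps inv)
  also have "\<dots> = J_hat \<Lambda> Q D"
    by (simp only: D BT B_def[symmetric])
  finally have "B ** matrix_inv A - A ** Y = D"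
    using inj_J_hat[OF A] by (auto dest: injD)
  then show ?thesis
    by (simp only: S_map_def A_def[symmetric] B_def[symmetric] Y_def[symmetric])
qed

text \<open>The contribution of \<open>S\<close> to the right-hand side vanishes by membership in
  \<open>weighted_pairs\<close>. So \<open>D_map Q S\<close> is the Sylvester solution attached to
  the image point, and \<open>S_map\<close> recovers \<open>S\<close>.\<close>

lemma J_hat_D_map:
  assumes K: "transpose (matrix_inv \<Lambda>) = matrix_inv \<Lambda>"
    and QS: "(Q, S) \<in> weighted_pairs (matrix_inv \<Lambda>)" and P: "P = S + D_map Q S ** Q"
  shows "J_hat \<Lambda> Q (D_map Q S)
    = Q ** matrix_inv \<Lambda> ** transpose P + P ** matrix_inv \<Lambda> ** transpose Q"
proof -
  have "transpose (D_map Q S) = D_map Q S"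
    by (simp add: D_map_def transpose_simps add.commute)
  then have "Q ** matrix_inv \<Lambda> ** transpose P + P ** matrix_inv \<Lambda> ** transpose Q
      = (Q ** matrix_inv \<Lambda> ** transpose S + S ** matrix_inv \<Lambda> ** transpose Q)
        + J_hat \<Lambda> Q (D_map Q S)"
    by (simp add: P J_hat_def transpose_simps matrix_mult_simps add_ac)
  then show ?thesis
    using QS by (simp add: weighted_pairs_def)
qed

text \<open>Adding \<open>D_map Q S ** Q\<close> changes
  \<open>Q ** transpose S + S ** transpose Q\<close> by twice \<open>D_map Q S\<close>, which
  cancels it.\<close>

lemma M_map_W0:
  fixes Q :: "real^'m^'n"
  assumes "Q ** transpose Q = mat 1"
  shows "M_map (Q, S) \<in> W0"
proof -
  have QQ: "Q ** (transpose Q ** Z) = Z" for Z :: "real^'k^'n"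
    using assms by (simp add: matrix_mul_assoc)
  have half: "(1/2) *\<^sub>R Z + (1/2) *\<^sub>R Z = Z" for Z :: "real^'n^'n"
    by (simp flip: scaleR_left_distrib)
  let ?D = "D_map Q S"
  have D: "transpose ?D = ?D"
    by (simp add: D_map_def transpose_simps add.commute)
  have "Q ** transpose (S + ?D ** Q) + (S + ?D ** Q) ** transpose Q
      = (Q ** transpose S + S ** transpose Q) + (?D + ?D)"
    by (simp add: transpose_simps matrix_mult_simps assms QQ D add_ac)
  also have "?D + ?D = - ((1/2) *\<^sub>R (Q ** transpose S + S ** transpose Q)
      + (1/2) *\<^sub>R (Q ** transpose S + S ** transpose Q))"
    by (simp only: D_map_def minus_add_distrib)
  finally show ?thesis
    by (simp only: half) (simp add: M_map_def W0_def assms)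
qed

text \<open>On \<open>W0\<close> the terms in \<open>P\<close> cancel, so \<open>D_map\<close> reads
  \<open>D\<close> back off \<open>P - D ** Q\<close>. Every symmetric \<open>D\<close> gives a
  preimage under \<open>M_map\<close>; the Sylvester equation selects the one in the cotangent
  bundle.\<close>

lemma M_map_symmetric_shift:
  fixes Q :: "real^'m^'n"
  assumes QP: "(Q, P) \<in> W0" and D: "transpose D = D"
  shows "M_map (Q, P - D ** Q) = (Q, P)"
proof -
  have Q: "Q ** transpose Q = mat 1" and P: "Q ** transpose P + P ** transpose Q = 0"
    using QP by (auto simp: W0_def)
  have QQ: "Q ** (transpose Q ** Z) = Z" for Z :: "real^'n^'n"
    using Q by (simp add: matrix_mul_assoc)
  have "Q ** transpose (P - D ** Q) + (P - D ** Q) ** transpose Q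
      = (Q ** transpose P + P ** transpose Q) - (D + D)"
    by (simp add: transpose_simps matrix_mult_simps Q QQ D)
  then have "D_map Q (P - D ** Q) = (1/2) *\<^sub>R (D + D)"
    by (simp add: D_map_def P)
  also have "\<dots> = D"
    by (simp flip: scaleR_2)
  finally show ?thesis
    by (simp add: M_map_def)
qed

lemma symmetric_solution_weighted_pairs:
  assumes K: "transpose (matrix_inv \<Lambda>) = matrix_inv \<Lambda>"
    and Q: "Q ** transpose Q = mat 1" and D: "transpose D = D"
    and J: "J_hat \<Lambda> Q D = Q ** matrix_inv \<Lambda> ** transpose P + P ** matrix_inv \<Lambda> ** transpose Q"
  shows "(Q, P - D ** Q) \<in> weighted_pairs (matrix_inv \<Lambda>)"
proof -
  have "Q ** matrix_inv \<Lambda> ** transpose (P - D ** Q) + (P - D ** Q) ** matrix_inv \<Lambda> ** transpose Q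
      = (Q ** matrix_inv \<Lambda> ** transpose P + P ** matrix_inv \<Lambda> ** transpose Q) - J_hat \<Lambda> Q D"
    by (simp add: J_hat_def transpose_simps matrix_mult_simps D)
  then show ?thesis
    by (simp add: weighted_pairs_def Q J)
qed

theorem proposition6:
  fixes \<Lambda> :: "real^'N^'N"
  assumes "CARD('n) \<le> CARD('N)" and "diagonal_matrix \<Lambda>" and "positive_definite \<Lambda>"
  shows
    "diffeomorphism (stiefel_cotangent_bundle \<Lambda> :: ((real^'N^'n) \<times> (real^'N^'n)) set) W0 M_map
     \<and> (\<forall>Q \<in> (stiefel :: (real^'N^'n) set). \<forall>U\<in>so. \<forall>S D.
          S = Q ** U ** \<Lambda> \<longrightarrow> D = (1/2) *\<^sub>R (Q ** commutator \<Lambda> U ** transpose Q) \<longrightarrow>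
            D = transpose D \<and> D = - ((1/2) *\<^sub>R (Q ** transpose S + S ** transpose Q)) \<and>
            M_map (Q, S) = (Q, S + D ** Q))
     \<and> (\<forall>(Q, P) \<in> (W0 :: ((real^'N^'n) \<times> (real^'N^'n)) set).
          invertible (Q ** matrix_inv \<Lambda> ** transpose Q) \<and>
          bij_betw (J_hat \<Lambda> Q) so so \<and>
          R0_map \<Lambda> Q P \<in> so \<and>
          inv_into (stiefel_cotangent_bundle \<Lambda>) M_map (Q, P) = (Q, S_map \<Lambda> Q P))"
proof -
  define K where "K = matrix_inv \<Lambda>"
  let ?X = "stiefel_cotangent_bundle \<Lambda> :: ((real^'N^'n) \<times> (real^'N^'n)) set"
  let ?W0 = "W0 :: ((real^'N^'n) \<times> (real^'N^'n)) set"
  have \<Lambda>: "transpose \<Lambda> = \<Lambda>"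
    using assms(3) by (simp add: positive_definite_def)
  have pdK: "positive_definite K"
    unfolding K_def by (rule positive_definite_matrix_inv[OF assms(3)])
  then have K: "transpose K = K"
    by (simp add: positive_definite_def)
  have inv: "\<Lambda> ** K = mat 1" "K ** \<Lambda> = mat 1"
    unfolding K_def by (rule invertible_matrix_inv[OF positive_definite_invertible[OF assms(3)]])+
  have X: "?X = weighted_pairs K"
    by (rule stiefel_cotangent_bundle_eq_weighted_pairs[OF \<Lambda> K inv])
  have pdA: "positive_definite (Q ** matrix_inv \<Lambda> ** transpose Q)"
    if "det (Q ** transpose Q) \<noteq> 0" for Q :: "real^'N^'n"
    using positive_definite_congruence[OF pdK that] by (simp add: K_def)
  define rhs where "rhs x = fst x ** matrix_inv \<Lambda> ** transpose (snd x)
      + snd x ** matrix_inv \<Lambda> ** transpose (fst x)" for x :: "(real^'N^'n) \<times> (real^'N^'n)"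
  \<comment> \<open>The inverse is taken on all matrices, not on \<open>so\<close>, and serves at
    every point of \<open>W\<close> below, not only on \<open>W0\<close>.\<close>
  define D where "D x = inv (J_hat \<Lambda> (fst x)) (rhs x)" for x :: "(real^'N^'n) \<times> (real^'N^'n)"
  \<comment> \<open>The matrices \<open>Q\<close> of full row rank: an open condition that holds on
    \<open>W0\<close> and keeps \<open>Q ** matrix_inv \<Lambda> ** transpose Q\<close> positive
    definite.\<close>
  define W where "W = {x :: (real^'N^'n) \<times> (real^'N^'n). det (fst x ** transpose (fst x)) \<noteq> 0}"
  have W0_W: "?W0 \<subseteq> W"
    by (auto simp: W0_def W_def)
  have J_D: "J_hat \<Lambda> (fst x) (D x) = rhs x" if "x \<in> W" for x
    using that surj_J_hat[OF pdA] by (simp add: W_def D_def surj_f_inv_f)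
  have D_sym: "transpose (D x) = D x" if "x \<in> W" for x
  proof -
    have pd: "positive_definite (fst x ** matrix_inv \<Lambda> ** transpose (fst x))"
      using pdA that by (simp add: W_def)
    have "J_hat \<Lambda> (fst x) (transpose (D x)) = transpose (rhs x)"
      using transpose_J_hat[OF pd, of "D x"] J_D[OF that] by simp
    also have "\<dots> = rhs x"
      by (simp add: rhs_def transpose_simps K[unfolded K_def] matrix_mul_assoc add.commute)
    also have "\<dots> = J_hat \<Lambda> (fst x) (D x)"
      by (simp add: J_D that)
    finally show ?thesis
      using inj_J_hat[OF pd] by (auto dest: injD)
  qed
  have S_map_D: "S_map \<Lambda> Q P = P - D (Q, P) ** Q" if "(Q, P) \<in> ?W0" for Q P
    using S_map_eq[OF K[unfolded K_def] pdA] J_D[of "(Q, P)"] that W0_W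
    by (auto simp: rhs_def W_def)

  \<comment> \<open>Bijectivity and the inverse formula\<close>
  have M_X: "M_map x \<in> ?W0" if "x \<in> ?X" for x
    using M_map_W0 that by (cases x) (auto simp: X weighted_pairs_def)
  have S_X: "(Q, S_map \<Lambda> Q P) \<in> ?X" "M_map (Q, S_map \<Lambda> Q P) = (Q, P)"
    if "(Q, P) \<in> ?W0" for Q P
  proof -
    have QP: "(Q, P) \<in> W" "Q ** transpose Q = mat 1"
      using that W0_W by (auto simp: W0_def)
    show "(Q, S_map \<Lambda> Q P) \<in> ?X"
      unfolding X K_def S_map_D[OF that]
      using symmetric_solution_weighted_pairs[OF K[unfolded K_def] QP(2) D_sym[OF QP(1)]]
        J_D[OF QP(1)] by (simp add: rhs_def)
    show "M_map (Q, S_map \<Lambda> Q P) = (Q, P)"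
      unfolding S_map_D[OF that] by (rule M_map_symmetric_shift[OF that D_sym[OF QP(1)]])
  qed
  have left_inv: "(Q, S_map \<Lambda> Q (snd (M_map (Q, S)))) = (Q, S)" if "(Q, S) \<in> ?X" for Q S
  proof -
    have QS: "(Q, S) \<in> weighted_pairs (matrix_inv \<Lambda>)"
      using that by (simp add: X K_def)
    then have "positive_definite (Q ** matrix_inv \<Lambda> ** transpose Q)"
      by (intro pdA) (simp add: weighted_pairs_def)
    from S_map_eq[OF K[unfolded K_def] this J_hat_D_map[OF K[unfolded K_def] QS refl]]
    show ?thesis by (simp add: M_map_def)
  qed
  have bij: "bij_betw M_map ?X ?W0"
    by (rule bij_betw_byWitness[where f' = "\<lambda>(Q, P). (Q, S_map \<Lambda> Q P)"])
      (use M_X S_X left_inv in \<open>auto simp: M_map_def split: prod.splits\<close>)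
  have inv_M: "inv_into ?X M_map (Q, P) = (Q, S_map \<Lambda> Q P)" if "(Q, P) \<in> ?W0" for Q P
    using S_X[OF that] bij inv_into_f_eq by (metis bij_betw_def)

  \<comment> \<open>Smoothness of the map and of its inverse\<close>
  note smooth_intros = smooth_on_Pair smooth_on_add smooth_on_diff smooth_on_uminus smooth_on_const
    smooth_on_bilinear[OF _ bounded_bilinear_matrix_mult] smooth_on_linear[OF _ bounded_linear_transpose]
    smooth_on_linear[OF _ bounded_linear_scaleR_right] smooth_on_linear[OF _ bounded_linear_fst]
    smooth_on_linear[OF _ bounded_linear_snd] smooth_on_ident
  have "smooth_on UNIV (\<lambda>x :: (real^'N^'n) \<times> (real^'N^'n).
      (fst x, snd x + - ((1/2) *\<^sub>R (fst x ** transpose (snd x) + snd x ** transpose (fst x))) ** fst x))"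
    by (intro smooth_intros open_UNIV)
  then have "smooth_on UNIV (M_map :: (real^'N^'n) \<times> (real^'N^'n) \<Rightarrow> _)"
    by (simp add: M_map_def D_map_def case_prod_unfold)
  then have smooth_M: "smooth_map_on ?X M_map"
    unfolding smooth_map_on_def by blast
  have "smooth_on UNIV (\<lambda>x :: (real^'N^'n) \<times> (real^'N^'n). det (fst x ** transpose (fst x)))"
    by (intro smooth_on_det open_UNIV smooth_on_linear[OF _ bounded_linear_vec_nth] smooth_intros)
  then have "open W"
    unfolding W_def
    by (intro open_Collect_neq continuous_on_const smooth_on_continuous)
  have "smooth_on W D"
  proof (rule smooth_on_linear_solution[OF \<open>open W\<close>, where L = "\<lambda>x. J_hat \<Lambda> (fst x)" and b = rhs])
    show "inj (J_hat \<Lambda> (fst x))" if "x \<in> W" for x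
      using that by (intro inj_J_hat pdA) (simp add: W_def)
    show "smooth_on W (\<lambda>x. J_hat \<Lambda> (fst x) v)" for v
      unfolding J_hat_def by (intro smooth_intros \<open>open W\<close>)
    show "smooth_on W rhs"
      unfolding rhs_def[abs_def] by (intro smooth_intros \<open>open W\<close>)
  qed (use J_D linear_J_hat in auto)
  \<comment> \<open>This map is defined on the open set \<open>W\<close> and agrees with the inverse
    on \<open>W0\<close>, so it is a smooth extension near every point at once.\<close>
  then have "smooth_on W (\<lambda>x. (fst x, snd x - D x ** fst x))"
    by (intro smooth_intros \<open>open W\<close>)
  moreover have "(fst x, snd x - D x ** fst x) = inv_into ?X M_map x" if "x \<in> ?W0" for x
    using that inv_M S_map_D by (cases x) simp
  ultimately have smooth_inv: "smooth_map_on ?W0 (inv_into ?X M_map)"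
    unfolding smooth_map_on_def using \<open>open W\<close> W0_W by blast
  have "diffeomorphism ?X ?W0 M_map"
    unfolding diffeomorphism_def
  proof (intro conjI bij smooth_M smooth_inv)
    show "\<exists>k. smooth_submanifold k ?X"
      unfolding X by (rule smooth_submanifold_weighted_pairs[OF K inv(1)])
    show "\<exists>k. smooth_submanifold k ?W0"
      unfolding W0_eq_weighted_pairs
      by (rule smooth_submanifold_weighted_pairs[of _ "mat 1"]) simp_all
  qed
  moreover have "D = transpose D \<and> D = - ((1/2) *\<^sub>R (Q ** transpose S + S ** transpose Q)) \<and>
      M_map (Q, S) = (Q, S + D ** Q)"
    if "U \<in> so" "S = Q ** U ** \<Lambda>" "D = (1/2) *\<^sub>R (Q ** commutator \<Lambda> U ** transpose Q)"
    for Q S :: "real^'N^'n" and U D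
  proof -
    have U: "transpose U = - U"
      using that by (simp add: so_def)
    \<comment> \<open>Skewness of \<open>U\<close> gives
      \<open>Q ** transpose S = - (Q ** \<Lambda> ** U ** transpose Q)\<close>, while
      \<open>S ** transpose Q = Q ** U ** \<Lambda> ** transpose Q\<close>; the negated sum is the
      commutator term.\<close>
    have "D = D_map Q S"
      by (simp add: that D_map_def commutator_def transpose_simps matrix_mult_simps U \<Lambda>
          scaleR_right_diff_distrib)
    moreover have "transpose (D_map Q S) = D_map Q S"
      by (simp add: D_map_def transpose_simps add.commute)
    ultimately show ?thesis
      by (simp add: M_map_def) (simp add: D_map_def)
  qed
  moreover have "invertible (Q ** matrix_inv \<Lambda> ** transpose Q) \<and> bij_betw (J_hat \<Lambda> Q) so so \<and>
      R0_map \<Lambda> Q P \<in> so \<and> inv_into ?X M_map (Q, P) = (Q, S_map \<Lambda> Q P)"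
    if "(Q, P) \<in> ?W0" for Q P
  proof -
    have pd: "positive_definite (Q ** matrix_inv \<Lambda> ** transpose Q)"
      using that by (intro pdA) (simp add: W0_def)
    show ?thesis
      using positive_definite_invertible[OF pd] bij_betw_J_hat_so[OF pd]
        R0_map_so[OF K[unfolded K_def] pd] inv_M[OF that] by blast
  qed
  ultimately show ?thesis
    by blast
qed

end
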